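(* Let $k$ be a commutative unital ring, $m\ge 2$, $n=m+1$. Let $A$ be a unital associative $k$-algebra, $c\in A^\times$, and $\sigma\in\mathrm{Aut}_k(A)$ with $\sigma(c)=c$ and $\sigma^m(a)=cac^{-1}$ for all $a\in A$. Then the $n$-ary multiplication $$\mu_{\sigma,c}(a_0,\ldots,a_m)=a_0\,\sigma(a_1)\cdots\sigma^{m-1}(a_{m-1})\,c\,a_m$$ on $A$ is totally associative. More generally, for every $q$ and all $a_0,\ldots,a_{qm}\in A$, every way of parenthesizing the word $a_0,\ldots,a_{qm}$ of length $1+qm$ into iterated applications of $\mu_{\sigma,c}$ has the common value $$\left(\prod_{j=0}^{qm}\sigma^j(a_j)\right)c^q,$$ where the factors of the product occur in increasing order of $j$.
   Context: Equivalently $\mu_{\sigma,c}(a_0,\ldots,a_m)=\bigl(\prod_{j=0}^{m}\sigma^j(a_j)\bigr)c$ (ordered product). An $n$-ary multilinear multiplication $\mu$ with $n=m+1$ is totally associative if for every word $a_0,\ldots,a_{2m}$ the $m+1$ elements $\mu(a_0,\ldots,a_{i-1},\mu(a_i,\ldots,a_{i+m}),a_{i+m+1},\ldots,a_{2m})$, $0\le i\le m$, are all equal. *)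

theory Defs
  imports "HOL-Algebra.Module" "HOL-Algebra.QuotRing"
begin

text \<open>Unital associative algebras over a commutative unital ring.  The locale
  \<open>algebra\<close> of HOL-Algebra additionally requires the algebra to be commutative.\<close>

locale assoc_algebra = module + ring M +
  assumes smult_mult_left:
      "\<lbrakk> r \<in> carrier R; x \<in> carrier M; y \<in> carrier M \<rbrakk> \<Longrightarrow>
      (r \<odot>\<^bsub>M\<^esub> x) \<otimes>\<^bsub>M\<^esub> y = r \<odot>\<^bsub>M\<^esub> (x \<otimes>\<^bsub>M\<^esub> y)"
    and smult_mult_right:
      "\<lbrakk> r \<in> carrier R; x \<in> carrier M; y \<in> carrier M \<rbrakk> \<Longrightarrow>
      x \<otimes>\<^bsub>M\<^esub> (r \<odot>\<^bsub>M\<^esub> y) = r \<odot>\<^bsub>M\<^esub> (x \<otimes>\<^bsub>M\<^esub> y)"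

definition algebra_auts ::
    "('k, 'r) ring_scheme \<Rightarrow> ('k, 'a, 'b) module_scheme \<Rightarrow> ('a \<Rightarrow> 'a) set" where
  "algebra_auts k A = {\<sigma> \<in> ring_iso A A.
     \<forall>r\<in>carrier k. \<forall>x\<in>carrier A. \<sigma> (r \<odot>\<^bsub>A\<^esub> x) = r \<odot>\<^bsub>A\<^esub> \<sigma> x}"

definition ordered_prod :: "('a, 'b) monoid_scheme \<Rightarrow> 'a list \<Rightarrow> 'a" where
  "ordered_prod G xs = foldr (\<otimes>\<^bsub>G\<^esub>) xs \<one>\<^bsub>G\<^esub>"

text \<open>An \<open>n\<close>-ary operation on \<open>A\<close> is a function on lists, of which only the values on
  lists of length \<open>n\<close> with entries in \<open>carrier A\<close> are relevant.\<close>

definition mu ::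
    "('a, 'b) ring_scheme \<Rightarrow> nat \<Rightarrow> ('a \<Rightarrow> 'a) \<Rightarrow> 'a \<Rightarrow> 'a list \<Rightarrow> 'a" where
  "mu A m \<sigma> c as =
     ordered_prod A (map (\<lambda>j. (\<sigma> ^^ j) (as ! j)) [0..<m]) \<otimes>\<^bsub>A\<^esub> c \<otimes>\<^bsub>A\<^esub> (as ! m)"

definition multilinear_op ::
    "('k, 'r) ring_scheme \<Rightarrow> ('k, 'a, 'b) module_scheme \<Rightarrow> nat \<Rightarrow> ('a list \<Rightarrow> 'a) \<Rightarrow> bool" where
  "multilinear_op k A n \<mu> \<longleftrightarrow>
     (\<forall>as. length as = n \<and> set as \<subseteq> carrier A \<longrightarrow>
        \<mu> as \<in> carrier A \<and>
        (\<forall>i<n. \<forall>x\<in>carrier A. \<forall>y\<in>carrier A.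
           \<mu> (as[i := x \<oplus>\<^bsub>A\<^esub> y]) = \<mu> (as[i := x]) \<oplus>\<^bsub>A\<^esub> \<mu> (as[i := y])) \<and>
        (\<forall>i<n. \<forall>r\<in>carrier k. \<forall>x\<in>carrier A.
           \<mu> (as[i := r \<odot>\<^bsub>A\<^esub> x]) = r \<odot>\<^bsub>A\<^esub> \<mu> (as[i := x])))"

text \<open>\<open>nested \<mu> m i as\<close> is
  \<open>\<mu>(a\<^sub>0, \<dots>, a\<^bsub>i-1\<^esub>, \<mu>(a\<^sub>i, \<dots>, a\<^bsub>i+m\<^esub>), a\<^bsub>i+m+1\<^esub>, \<dots>, a\<^bsub>2m\<^esub>)\<close>.\<close>

definition nested :: "('a list \<Rightarrow> 'a) \<Rightarrow> nat \<Rightarrow> nat \<Rightarrow> 'a list \<Rightarrow> 'a" where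
  "nested \<mu> m i as = \<mu> (take i as @ [\<mu> (take (m + 1) (drop i as))] @ drop (i + m + 1) as)"

definition totally_associative ::
    "('k, 'r) ring_scheme \<Rightarrow> ('k, 'a, 'b) module_scheme \<Rightarrow> nat \<Rightarrow> ('a list \<Rightarrow> 'a) \<Rightarrow> bool" where
  "totally_associative k A m \<mu> \<longleftrightarrow>
     multilinear_op k A (m + 1) \<mu> \<and>
     (\<forall>as. length as = 2 * m + 1 \<and> set as \<subseteq> carrier A \<longrightarrow>
        (\<forall>i\<le>m. \<forall>j\<le>m. nested \<mu> m i as = nested \<mu> m j as))"

text \<open>A parenthesization of a word into iterated applications of an \<open>n\<close>-ary operation is a
  plane rooted tree all of whose inner nodes have exactly \<open>n\<close> children and whose leaves,
  read from left to right, spell the word.\<close>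

datatype 'a ptree = Leaf 'a | Node "'a ptree list"

fun leaves :: "'a ptree \<Rightarrow> 'a list" where
  "leaves (Leaf a) = [a]"
| "leaves (Node ts) = concat (map leaves ts)"

fun nary :: "nat \<Rightarrow> 'a ptree \<Rightarrow> bool" where
  "nary n (Leaf a) \<longleftrightarrow> True"
| "nary n (Node ts) \<longleftrightarrow> length ts = n \<and> (\<forall>t\<in>set ts. nary n t)"

definition parenthesizations :: "nat \<Rightarrow> 'a list \<Rightarrow> 'a ptree set" where
  "parenthesizations n as = {t. nary n t \<and> leaves t = as}"

fun eval_tree :: "('a list \<Rightarrow> 'a) \<Rightarrow> 'a ptree \<Rightarrow> 'a" where
  "eval_tree \<mu> (Leaf a) = a"
| "eval_tree \<mu> (Node ts) = \<mu> (map (eval_tree \<mu>) ts)"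

end

theory Submission
  imports Defs
begin

text \<open>Adjoin to \<open>A\<close> an invertible letter \<open>u\<close> with \<open>u a = \<sigma>(a) u\<close> and impose
  \<open>u\<^sup>m = c\<close>.  The hypotheses \<open>\<sigma>(c) = c\<close> and \<open>\<sigma>\<^sup>m(a) = c a c\<^sup>-\<^sup>1\<close> say that this relation is
  compatible with the commutation rule, and moving all letters \<open>u\<close> to the right turns the
  binary product
  \<open>a\<^sub>0 u a\<^sub>1 u \<dots> u a\<^sub>m\<close> into \<open>a\<^sub>0 \<sigma>(a\<^sub>1) \<dots> \<sigma>\<^sup>m(a\<^sub>m) u\<^sup>m = \<mu>(a\<^sub>0, \<dots>, a\<^sub>m)\<close>.  So \<open>\<mu>\<close> is an iterate of the
  associative operation \<open>(a, b) \<mapsto> a u b\<close>, every parenthesization of \<open>a\<^sub>0, \<dots>, a\<^bsub>qm\<^esub>\<close> has the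
  value \<open>a\<^sub>0 u a\<^sub>1 u \<dots> u a\<^bsub>qm\<^esub>\<close>, and the letters \<open>u\<close>, of which there are \<open>qm\<close>, collect to \<open>c\<^sup>q\<close>.

  The proof carries out this computation without constructing the extension.  The product
  \<open>\<Prod>\<^sub>j \<sigma>\<^sup>j(a\<^sub>j)\<close> is the coefficient of \<open>(a\<^sub>0 u) (a\<^sub>1 u) \<dots>\<close>, and it satisfies the
  concatenation rule \<open>twisted_prod_append\<close>.  Together with \<open>pow_commute\<close>, which is
  \<open>u\<^bsup>qm\<^esup> b = \<sigma>\<^bsup>qm\<^esup>(b) u\<^bsup>qm\<^esup>\<close> with \<open>c\<^sup>q\<close> in place of \<open>u\<^bsup>qm\<^esup>\<close>, it shows in
  \<open>twisted_prod_concat\<close> that replacing the letters of a word by values of subwords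
  merely concatenates the subwords and multiplies the powers of \<open>c\<close>.  Induction on the tree then
  evaluates all parenthesizations.  Total associativity is the case \<open>q = 2\<close>, where the
  \<open>m + 1\<close> nested products are values of trees with the same leaves.\<close>

section \<open>Twisted products in a monoid\<close>

primrec twisted_prod :: "('a, 'b) monoid_scheme \<Rightarrow> ('a \<Rightarrow> 'a) \<Rightarrow> 'a list \<Rightarrow> 'a" where
  "twisted_prod G \<sigma> [] = \<one>\<^bsub>G\<^esub>"
| "twisted_prod G \<sigma> (x # xs) = x \<otimes>\<^bsub>G\<^esub> \<sigma> (twisted_prod G \<sigma> xs)"

locale monoid_endo = monoid G for G (structure) +
  fixes \<sigma> :: "'a \<Rightarrow> 'a"
  assumes endo_hom: "\<sigma> \<in> hom G G"
    and endo_one: "\<sigma> \<one> = \<one>"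
begin

lemma endo_closed: "x \<in> carrier G \<Longrightarrow> \<sigma> x \<in> carrier G"
  using endo_hom by (rule hom_in_carrier)

lemma endo_mult: "x \<in> carrier G \<Longrightarrow> y \<in> carrier G \<Longrightarrow> \<sigma> (x \<otimes> y) = \<sigma> x \<otimes> \<sigma> y"
  using endo_hom by (rule hom_mult)

lemma funpow_closed: "x \<in> carrier G \<Longrightarrow> (\<sigma> ^^ n) x \<in> carrier G"
  by (induction n) (auto simp: endo_closed)

lemma twisted_prod_closed: "set xs \<subseteq> carrier G \<Longrightarrow> twisted_prod G \<sigma> xs \<in> carrier G"
  by (induction xs) (auto simp: endo_closed)

lemma ordered_prod_closed: "set xs \<subseteq> carrier G \<Longrightarrow> ordered_prod G xs \<in> carrier G"
  by (induction xs) (auto simp: ordered_prod_def)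

lemma endo_ordered_prod:
  assumes "set xs \<subseteq> carrier G"
  shows "\<sigma> (ordered_prod G xs) = ordered_prod G (map \<sigma> xs)"
  using assms
proof (induction xs)
  case Nil
  show ?case by (simp add: ordered_prod_def endo_one)
next
  case (Cons x xs)
  have "\<sigma> (ordered_prod G (x # xs)) = \<sigma> (x \<otimes> ordered_prod G xs)"
    by (simp add: ordered_prod_def)
  also have "\<dots> = \<sigma> x \<otimes> \<sigma> (ordered_prod G xs)"
    using Cons.prems ordered_prod_closed by (simp add: endo_mult)
  finally show ?case
    using Cons by (simp add: ordered_prod_def)
qed

text \<open>The recursion for the twisted product is Horner's scheme for the closed form.\<close>

lemma ordered_prod_eq_twisted_prod:
  assumes "set xs \<subseteq> carrier G"
  shows "ordered_prod G (map (\<lambda>j. (\<sigma> ^^ j) (xs ! j)) [0..<length xs]) = twisted_prod G \<sigma> xs"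
  using assms
proof (induction xs)
  case Nil
  show ?case by (simp add: ordered_prod_def)
next
  case (Cons x xs)
  let ?ys = "map (\<lambda>j. (\<sigma> ^^ j) (xs ! j)) [0..<length xs]"
  have ys: "set ?ys \<subseteq> carrier G"
    using Cons.prems by (auto intro!: funpow_closed)
  have "map (\<lambda>j. (\<sigma> ^^ j) ((x # xs) ! j)) [0..<length (x # xs)] = x # map \<sigma> ?ys"
    by (simp add: upt_conv_Cons map_Suc_upt[symmetric] del: upt_Suc)
  then have "ordered_prod G (map (\<lambda>j. (\<sigma> ^^ j) ((x # xs) ! j)) [0..<length (x # xs)])
      = x \<otimes> ordered_prod G (map \<sigma> ?ys)"
    by (simp only: ordered_prod_def foldr_Cons comp_apply)
  also have "\<dots> = x \<otimes> \<sigma> (ordered_prod G ?ys)"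
    by (simp only: endo_ordered_prod[OF ys])
  finally show ?case
    using Cons by simp
qed

text \<open>Carrying a word \<open>ys\<close> past the \<open>length xs\<close> letters \<open>u\<close> of \<open>xs\<close> costs one \<open>\<sigma>\<close> per letter.\<close>

lemma twisted_prod_append:
  assumes "set xs \<subseteq> carrier G" "set ys \<subseteq> carrier G"
  shows "twisted_prod G \<sigma> (xs @ ys)
    = twisted_prod G \<sigma> xs \<otimes> (\<sigma> ^^ length xs) (twisted_prod G \<sigma> ys)"
  using assms
  by (induction xs)
    (auto simp: twisted_prod_closed funpow_closed endo_closed endo_mult m_assoc)

lemma twisted_prod_update:
  assumes "set xs \<subseteq> carrier G" "i < length xs" "x \<in> carrier G"
  shows "twisted_prod G \<sigma> (xs[i := x])
    = twisted_prod G \<sigma> (take i xs) \<otimes> (\<sigma> ^^ i) x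
      \<otimes> (\<sigma> ^^ Suc i) (twisted_prod G \<sigma> (drop (Suc i) xs))"
proof -
  have sets: "set (take i xs) \<subseteq> carrier G" "set (drop (Suc i) xs) \<subseteq> carrier G"
    using assms(1) set_take_subset set_drop_subset by fast+
  let ?w = "twisted_prod G \<sigma> (drop (Suc i) xs)"
  have w: "?w \<in> carrier G"
    using sets(2) by (rule twisted_prod_closed)
  have pow_mult: "(\<sigma> ^^ i) (a \<otimes> b) = (\<sigma> ^^ i) a \<otimes> (\<sigma> ^^ i) b"
    if "a \<in> carrier G" "b \<in> carrier G" for a b
    using that by (induction i) (auto simp: funpow_closed endo_mult)
  have "twisted_prod G \<sigma> (xs[i := x])
      = twisted_prod G \<sigma> (take i xs) \<otimes> (\<sigma> ^^ i) (x \<otimes> \<sigma> ?w)"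
    using twisted_prod_append[of "take i xs" "x # drop (Suc i) xs"] sets assms
    by (simp add: upd_conv_take_nth_drop)
  also have "(\<sigma> ^^ i) (x \<otimes> \<sigma> ?w) = (\<sigma> ^^ i) x \<otimes> (\<sigma> ^^ Suc i) ?w"
    using assms(3) w by (simp add: pow_mult endo_closed funpow_swap1)
  finally show ?thesis
    using assms(3) w sets(1) twisted_prod_closed funpow_closed m_assoc by metis
qed

end

section \<open>Evaluation of parenthesizations\<close>

text \<open>The last assumption is \<open>\<sigma>\<^sup>m(a) = c a c\<^sup>-\<^sup>1\<close> with the denominator cleared; it says that \<open>c\<close>
  commutes with elements in the same way as \<open>u\<^sup>m\<close> does.\<close>

locale endo_root = monoid_endo G \<sigma>
  for G :: "('a, 'b) ring_scheme" (structure) and \<sigma> :: "'a \<Rightarrow> 'a" +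
  fixes c :: 'a and m :: nat
  assumes c_closed: "c \<in> carrier G"
    and endo_c: "\<sigma> c = c"
    and c_commute: "a \<in> carrier G \<Longrightarrow> (\<sigma> ^^ m) a \<otimes> c = c \<otimes> a"
begin

lemma pow_commute:
  assumes "b \<in> carrier G"
  shows "c [^] (q :: nat) \<otimes> b = (\<sigma> ^^ (q * m)) b \<otimes> c [^] q"
  using assms
proof (induction q arbitrary: b)
  case 0
  then show ?case by simp
next
  case (Suc q)
  have "c [^] Suc q \<otimes> b = c [^] q \<otimes> (c \<otimes> b)"
    using Suc.prems c_closed by (simp add: m_assoc)
  also have "\<dots> = c [^] q \<otimes> (\<sigma> ^^ m) b \<otimes> c"
    using Suc.prems c_closed by (simp add: c_commute[symmetric] m_assoc funpow_closed)
  also have "\<dots> = (\<sigma> ^^ (q * m)) ((\<sigma> ^^ m) b) \<otimes> c [^] q \<otimes> c"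
    using Suc by (simp add: funpow_closed)
  also have "(\<sigma> ^^ (q * m)) ((\<sigma> ^^ m) b) = (\<sigma> ^^ (Suc q * m)) b"
    by (simp add: funpow_add[symmetric, THEN fun_cong, unfolded comp_apply] add.commute)
  finally show ?case
    using Suc.prems c_closed by (simp add: m_assoc funpow_closed)
qed

lemma endo_pow_c: "\<sigma> (c [^] (q :: nat)) = c [^] q"
  by (induction q) (auto simp: endo_one endo_mult endo_c c_closed)

text \<open>Moving \<open>c\<close> to the end makes all arguments of \<open>\<mu>\<close> enter in the same way.\<close>

lemma mu_eq_twisted_prod:
  assumes "length as = m + 1" "set as \<subseteq> carrier G"
  shows "mu G m \<sigma> c as = twisted_prod G \<sigma> as \<otimes> c"
proof -
  obtain bs a where as: "as = bs @ [a]" and bs: "length bs = m"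
    using assms(1) by (metis Suc_eq_plus1 length_Suc_conv_rev)
  have closed: "set bs \<subseteq> carrier G" "a \<in> carrier G"
    using assms(2) as by auto
  have "map (\<lambda>j. (\<sigma> ^^ j) (as ! j)) [0..<m] = map (\<lambda>j. (\<sigma> ^^ j) (bs ! j)) [0..<length bs]"
    using as bs by (auto simp: nth_append)
  then have "ordered_prod G (map (\<lambda>j. (\<sigma> ^^ j) (as ! j)) [0..<m]) = twisted_prod G \<sigma> bs"
    using ordered_prod_eq_twisted_prod[OF closed(1)] by metis
  moreover have "as ! m = a"
    using as bs by (simp add: nth_append)
  ultimately have "mu G m \<sigma> c as = twisted_prod G \<sigma> bs \<otimes> c \<otimes> a"
    by (simp only: mu_def)
  also have "\<dots> = twisted_prod G \<sigma> bs \<otimes> (\<sigma> ^^ m) a \<otimes> c"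
    using closed c_closed by (simp add: c_commute m_assoc twisted_prod_closed funpow_closed)
  also have "twisted_prod G \<sigma> bs \<otimes> (\<sigma> ^^ m) a = twisted_prod G \<sigma> as"
    using closed as bs by (simp add: twisted_prod_append endo_one)
  finally show ?thesis .
qed

text \<open>With one \<open>u\<close> after every letter, a word of length \<open>1 + q m\<close> carries \<open>1 + q m\<close> letters
  \<open>u\<close>: \<open>q m\<close> of them make up the \<open>c\<^sup>q\<close> in its value, and the remaining one follows that
  value when it serves as a letter itself.  Hence values of words multiply like the
  concatenation of the words.\<close>

lemma twisted_prod_concat:
  assumes "\<And>t. t \<in> set ts \<Longrightarrow> set (w t) \<subseteq> carrier G"
    and "\<And>t. t \<in> set ts \<Longrightarrow> length (w t) = 1 + q t * m"
    and "\<And>t. t \<in> set ts \<Longrightarrow> v t = twisted_prod G \<sigma> (w t) \<otimes> c [^] (q t :: nat)"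
  shows "twisted_prod G \<sigma> (map v ts)
    = twisted_prod G \<sigma> (concat (map w ts)) \<otimes> c [^] (\<Sum>t\<leftarrow>ts. q t)"
  using assms
proof (induction ts)
  case Nil
  show ?case by simp
next
  case (Cons t ts)
  let ?W = "twisted_prod G \<sigma> (concat (map w ts))"
  let ?Q = "\<Sum>t\<leftarrow>ts. q t"
  let ?P = "twisted_prod G \<sigma> (w t)"
  have words: "set (w t) \<subseteq> carrier G" "set (concat (map w ts)) \<subseteq> carrier G"
    using Cons.prems(1) by auto
  have W: "?W \<in> carrier G" and P: "?P \<in> carrier G"
    using words twisted_prod_closed by auto
  have IH: "twisted_prod G \<sigma> (map v ts) = ?W \<otimes> c [^] ?Q"
    using Cons by simp
  have "twisted_prod G \<sigma> (map v (t # ts)) = ?P \<otimes> c [^] q t \<otimes> \<sigma> (?W \<otimes> c [^] ?Q)"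
    using Cons.prems(3)[of t] IH by simp
  also have "\<dots> = ?P \<otimes> (c [^] q t \<otimes> \<sigma> ?W) \<otimes> c [^] ?Q"
    using W P c_closed by (simp add: endo_mult endo_pow_c endo_closed m_assoc)
  also have "\<dots> = ?P \<otimes> (\<sigma> ^^ (q t * m)) (\<sigma> ?W) \<otimes> (c [^] q t \<otimes> c [^] ?Q)"
    using W P c_closed by (simp add: pow_commute endo_closed funpow_closed m_assoc)
  also have "(\<sigma> ^^ (q t * m)) (\<sigma> ?W) = (\<sigma> ^^ length (w t)) ?W"
    using Cons.prems(2)[of t] by (simp add: funpow_swap1)
  also have "?P \<otimes> (\<sigma> ^^ length (w t)) ?W = twisted_prod G \<sigma> (concat (map w (t # ts)))"
    using twisted_prod_append[OF words] by simp
  finally show ?case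
    using c_closed by (simp add: nat_pow_mult)
qed

lemma eval_tree_mu_exists:
  assumes "nary (m + 1) t" "set (leaves t) \<subseteq> carrier G"
  shows "\<exists>q. length (leaves t) = 1 + q * m \<and>
    eval_tree (mu G m \<sigma> c) t = twisted_prod G \<sigma> (leaves t) \<otimes> c [^] (q :: nat)"
  using assms
proof (induction t)
  case (Leaf a)
  then show ?case by (auto simp: endo_one intro: exI[of _ 0])
next
  case (Node ts)
  let ?v = "eval_tree (mu G m \<sigma> c)"
  have words: "set (leaves t) \<subseteq> carrier G" if "t \<in> set ts" for t
    using Node.prems(2) that by auto
  have "\<forall>t\<in>set ts. \<exists>q. length (leaves t) = 1 + q * m \<and>
      ?v t = twisted_prod G \<sigma> (leaves t) \<otimes> c [^] (q :: nat)"
    using Node.IH Node.prems(1) words by simp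
  then obtain q :: "'a ptree \<Rightarrow> nat" where
    len: "\<And>t. t \<in> set ts \<Longrightarrow> length (leaves t) = 1 + q t * m" and
    val: "\<And>t. t \<in> set ts \<Longrightarrow> ?v t = twisted_prod G \<sigma> (leaves t) \<otimes> c [^] q t"
    by metis
  let ?Q = "\<Sum>t\<leftarrow>ts. q t"
  have card: "length ts = m + 1"
    using Node.prems(1) by simp
  have "length (concat (map leaves ts)) = length ts + ?Q * m"
    using len by (induction ts) (auto simp: algebra_simps)
  then have length: "length (leaves (Node ts)) = 1 + Suc ?Q * m"
    using card by simp
  have closed: "set (map ?v ts) \<subseteq> carrier G"
    using val words c_closed by (auto simp: twisted_prod_closed)
  have leaves: "twisted_prod G \<sigma> (leaves (Node ts)) \<in> carrier G"
    using Node.prems(2) by (rule twisted_prod_closed)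
  have "?v (Node ts) = twisted_prod G \<sigma> (map ?v ts) \<otimes> c"
    using mu_eq_twisted_prod[OF _ closed] card by simp
  also have "\<dots> = twisted_prod G \<sigma> (leaves (Node ts)) \<otimes> c [^] ?Q \<otimes> c"
    using twisted_prod_concat[of ts leaves q ?v, OF words len val] by simp
  also have "\<dots> = twisted_prod G \<sigma> (leaves (Node ts)) \<otimes> c [^] Suc ?Q"
    using leaves c_closed by (simp add: m_assoc)
  finally show ?case
    using length by blast
qed

lemma eval_tree_mu:
  assumes "m > 0" "t \<in> parenthesizations (m + 1) as"
    and "length as = 1 + q * m" "set as \<subseteq> carrier G"
  shows "eval_tree (mu G m \<sigma> c) t = twisted_prod G \<sigma> as \<otimes> c [^] q"
proof -
  have t: "nary (m + 1) t" "leaves t = as"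
    using assms(2) by (auto simp: parenthesizations_def)
  then obtain q' where q': "length as = 1 + q' * m"
    "eval_tree (mu G m \<sigma> c) t = twisted_prod G \<sigma> as \<otimes> c [^] q'"
    using eval_tree_mu_exists[of t] assms(4) by auto
  then have "q' = q"
    using assms(1,3) by simp
  then show ?thesis
    using q'(2) by simp
qed

end

text \<open>The nested product is the value of a tree with one inner node below the root, so that the
  evaluation of trees covers total associativity.\<close>

lemma nested_eq_eval_tree:
  assumes "length as = 2 * m + 1" "i \<le> m"
  shows "\<exists>t \<in> parenthesizations (m + 1) as. nested \<mu> m i as = eval_tree \<mu> t"
proof
  let ?t = "Node (map Leaf (take i as) @
    [Node (map Leaf (take (m + 1) (drop i as)))] @ map Leaf (drop (i + m + 1) as))"
  have eval: "map (eval_tree \<mu>) (map Leaf xs) = xs" for xs :: "'a list"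
    by (induction xs) auto
  have leaves: "concat (map leaves (map Leaf xs)) = xs" for xs :: "'a list"
    by (induction xs) auto
  have split: "take i as @ take (m + 1) (drop i as) @ drop (i + m + 1) as = as"
    by (metis add.assoc add.commute append_take_drop_id drop_drop)
  show "?t \<in> parenthesizations (m + 1) as"
    using assms split leaves by (auto simp: parenthesizations_def simp del: map_map)
  show "nested \<mu> m i as = eval_tree \<mu> ?t"
    by (simp add: nested_def eval del: map_map)
qed

section \<open>Multilinearity\<close>

locale algebra_endo_root = assoc_algebra R M + endo_root M \<sigma> c m
  for R :: "('k, 'r) ring_scheme" and M :: "('k, 'a, 'b) module_scheme"
    and \<sigma> :: "'a \<Rightarrow> 'a" and c :: 'a and m :: nat +
  assumes endo_add: "x \<in> carrier M \<Longrightarrow> y \<in> carrier M \<Longrightarrow> \<sigma> (x \<oplus>\<^bsub>M\<^esub> y) = \<sigma> x \<oplus>\<^bsub>M\<^esub> \<sigma> y"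
    and endo_smult: "r \<in> carrier R \<Longrightarrow> x \<in> carrier M \<Longrightarrow> \<sigma> (r \<odot>\<^bsub>M\<^esub> x) = r \<odot>\<^bsub>M\<^esub> \<sigma> x"
begin

lemma funpow_endo_add:
  "x \<in> carrier M \<Longrightarrow> y \<in> carrier M \<Longrightarrow> (\<sigma> ^^ i) (x \<oplus>\<^bsub>M\<^esub> y) = (\<sigma> ^^ i) x \<oplus>\<^bsub>M\<^esub> (\<sigma> ^^ i) y"
  by (induction i) (auto simp: endo_add funpow_closed)

lemma funpow_smult:
  "r \<in> carrier R \<Longrightarrow> x \<in> carrier M \<Longrightarrow> (\<sigma> ^^ i) (r \<odot>\<^bsub>M\<^esub> x) = r \<odot>\<^bsub>M\<^esub> (\<sigma> ^^ i) x"
  by (induction i) (auto simp: endo_smult funpow_closed)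

text \<open>As a function of one argument, \<open>\<mu>\<close> is a power of the linear map \<open>\<sigma>\<close> followed by
  a left and a right multiplication.\<close>

lemma multilinear_mu: "multilinear_op R M (m + 1) (mu M m \<sigma> c)"
  unfolding multilinear_op_def
proof (intro allI impI conjI ballI; elim conjE)
  fix as :: "'a list"
  assume as: "length as = m + 1" "set as \<subseteq> carrier M"
  show "mu M m \<sigma> c as \<in> carrier M"
    using as by (simp add: mu_eq_twisted_prod twisted_prod_closed c_closed)
  fix i
  assume i: "i < m + 1"
  define p where "p = twisted_prod M \<sigma> (take i as)"
  define s where "s = (\<sigma> ^^ Suc i) (twisted_prod M \<sigma> (drop (Suc i) as)) \<otimes>\<^bsub>M\<^esub> c"
  have sets: "set (take i as) \<subseteq> carrier M" "set (drop (Suc i) as) \<subseteq> carrier M"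
    using as(2) set_take_subset set_drop_subset by fast+
  have p: "p \<in> carrier M"
    unfolding p_def using sets(1) by (rule twisted_prod_closed)
  have tail: "(\<sigma> ^^ Suc i) (twisted_prod M \<sigma> (drop (Suc i) as)) \<in> carrier M"
    using sets(2) by (intro funpow_closed twisted_prod_closed)
  then have s: "s \<in> carrier M"
    unfolding s_def using c_closed by (rule m_closed)
  have slot: "mu M m \<sigma> c (as[i := x]) = p \<otimes>\<^bsub>M\<^esub> (\<sigma> ^^ i) x \<otimes>\<^bsub>M\<^esub> s" if x: "x \<in> carrier M" for x
  proof -
    have "set (as[i := x]) \<subseteq> carrier M"
      using set_update_subset_insert[of as i x] as(2) x by blast
    then have "mu M m \<sigma> c (as[i := x]) = twisted_prod M \<sigma> (as[i := x]) \<otimes>\<^bsub>M\<^esub> c"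
      using as(1) by (intro mu_eq_twisted_prod) auto
    also have "\<dots> = p \<otimes>\<^bsub>M\<^esub> (\<sigma> ^^ i) x
        \<otimes>\<^bsub>M\<^esub> (\<sigma> ^^ Suc i) (twisted_prod M \<sigma> (drop (Suc i) as)) \<otimes>\<^bsub>M\<^esub> c"
      using twisted_prod_update[OF as(2) _ x, of i] i as(1) unfolding p_def by simp
    finally show ?thesis
      unfolding s_def using m_assoc[OF _ tail c_closed] p funpow_closed[OF x] by simp
  qed
  show "mu M m \<sigma> c (as[i := x \<oplus>\<^bsub>M\<^esub> y])
      = mu M m \<sigma> c (as[i := x]) \<oplus>\<^bsub>M\<^esub> mu M m \<sigma> c (as[i := y])"
    if "x \<in> carrier M" "y \<in> carrier M" for x y
    using that p s by (simp add: slot funpow_endo_add funpow_closed r_distr l_distr)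
  show "mu M m \<sigma> c (as[i := r \<odot>\<^bsub>M\<^esub> x]) = r \<odot>\<^bsub>M\<^esub> mu M m \<sigma> c (as[i := x])"
    if "r \<in> carrier R" "x \<in> carrier M" for r x
    using that p s
    by (simp add: slot funpow_smult funpow_closed smult_mult_left smult_mult_right)
qed

end

section \<open>Total associativity and the common value\<close>

theorem theorem2p2:
  fixes k :: "('k, 'r) ring_scheme"
    and A :: "('k, 'a, 'b) module_scheme"
    and m :: nat
    and \<sigma> :: "'a \<Rightarrow> 'a"
    and c :: 'a
  assumes "assoc_algebra k A"
    and "m \<ge> 2"
    and "c \<in> Units A"
    and "\<sigma> \<in> algebra_auts k A"
    and "\<sigma> c = c"
    and "\<And>a. a \<in> carrier A \<Longrightarrow> (\<sigma> ^^ m) a = c \<otimes>\<^bsub>A\<^esub> a \<otimes>\<^bsub>A\<^esub> inv\<^bsub>A\<^esub> c"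
  shows "totally_associative k A m (mu A m \<sigma> c) \<and>
    (\<forall>q as t. length as = 1 + q * m \<and> set as \<subseteq> carrier A \<and>
        t \<in> parenthesizations (m + 1) as \<longrightarrow>
      eval_tree (mu A m \<sigma> c) t =
        ordered_prod A (map (\<lambda>j. (\<sigma> ^^ j) (as ! j)) [0..<q * m + 1]) \<otimes>\<^bsub>A\<^esub> c [^]\<^bsub>A\<^esub> q)"
proof -
  interpret assoc_algebra k A by fact
  have iso: "\<sigma> \<in> ring_hom A A"
    and smult: "\<And>r x. r \<in> carrier k \<Longrightarrow> x \<in> carrier A \<Longrightarrow> \<sigma> (r \<odot>\<^bsub>A\<^esub> x) = r \<odot>\<^bsub>A\<^esub> \<sigma> x"
    using assms(4) by (auto simp: algebra_auts_def ring_iso_def)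
  have c: "c \<in> carrier A"
    using assms(3) by (rule Units_closed)
  have commute: "(\<sigma> ^^ m) a \<otimes>\<^bsub>A\<^esub> c = c \<otimes>\<^bsub>A\<^esub> a" if "a \<in> carrier A" for a
    using assms(3,6) that c by (simp add: m_assoc)
  interpret algebra_endo_root k A \<sigma> c m
    using iso smult c commute assms(5)
    by unfold_locales (auto simp: hom_def ring_hom_def)
  have "m > 0"
    using assms(2) by simp
  have evaluate: "eval_tree (mu A m \<sigma> c) t = twisted_prod A \<sigma> as \<otimes>\<^bsub>A\<^esub> c [^]\<^bsub>A\<^esub> q"
    if "length as = 1 + q * m" "set as \<subseteq> carrier A" "t \<in> parenthesizations (m + 1) as"
    for q as t
    using eval_tree_mu \<open>m > 0\<close> that by blast
  have nested: "nested (mu A m \<sigma> c) m i as = twisted_prod A \<sigma> as \<otimes>\<^bsub>A\<^esub> c [^]\<^bsub>A\<^esub> (2 :: nat)"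
    if word: "length as = 2 * m + 1" "set as \<subseteq> carrier A" "i \<le> m" for i as
  proof -
    obtain t where "t \<in> parenthesizations (m + 1) as"
      "nested (mu A m \<sigma> c) m i as = eval_tree (mu A m \<sigma> c) t"
      using nested_eq_eval_tree[OF word(1,3)] by blast
    then show ?thesis
      using evaluate[of as 2 t] word by simp
  qed
  have "totally_associative k A m (mu A m \<sigma> c)"
    unfolding totally_associative_def using multilinear_mu nested by simp
  moreover have "eval_tree (mu A m \<sigma> c) t =
      ordered_prod A (map (\<lambda>j. (\<sigma> ^^ j) (as ! j)) [0..<q * m + 1]) \<otimes>\<^bsub>A\<^esub> c [^]\<^bsub>A\<^esub> q"
    if "length as = 1 + q * m" "set as \<subseteq> carrier A" "t \<in> parenthesizations (m + 1) as"
    for q as t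
    using evaluate[OF that] ordered_prod_eq_twisted_prod[OF that(2)] that(1)
    by (simp del: upt_Suc)
  ultimately show ?thesis
    by blast
qed

end
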